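(* Let $k$ be an algebraically closed field of characteristic $0$ and let $R=k\langle x,y\mid xy-yx=y^2\rangle$. All automorphisms of $R$ (as a $k$-algebra) are of the form $x\mapsto \alpha x+p(y)$, $y\mapsto\alpha y$, where $\alpha\in k\setminus\{0\}$ and $p\in k[y]$ is a polynomial in $y$. Hence the group $\mathrm{Aut}(R)$ of automorphisms is isomorphic to a semidirect product of the additive group of polynomials $k[y]$ (as the normal factor) and the multiplicative group $k^*$ of the field $k$. *)

theory Defs
  imports
    "HOL-Library.Poly_Mapping"
    "HOL-Computational_Algebra.Polynomial"
    "HOL-Algebra.Bij"
begin

section \<open>Free algebras\<close>

text \<open>
  Finitely supported functions into a ring carry the convolution product of \<^theory>\<open>HOL-Library.Poly_Mapping\<close>,
  which expects the indices to form an additive monoid. Writing concatenation of words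
  additively makes the finitely supported functions on words the free associative algebra.
\<close>

instantiation list :: (type) monoid_add
begin

definition zero_list_def: "0 = []"
definition plus_list_def: "xs + ys = xs @ ys"

instance
  by standard (simp_all add: zero_list_def plus_list_def)

end

type_synonym ('g, 'k) free_algebra = "'g list \<Rightarrow>\<^sub>0 'k"

definition free_var :: "'g \<Rightarrow> ('g, 'k::zero_neq_one) free_algebra"
  where "free_var g = Poly_Mapping.single [g] 1"

definition free_const :: "'k::zero \<Rightarrow> ('g, 'k) free_algebra"
  where "free_const c = Poly_Mapping.single [] c"

lemma free_const_add: "free_const (c + d) = free_const c + free_const d"
  by (simp add: free_const_def single_add)

lemma free_const_mult: "free_const (c * d) = free_const c * free_const d"
  by (simp add: free_const_def mult_single flip: zero_list_def)

lemma free_const_1: "free_const 1 = 1"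
  by (simp add: free_const_def flip: zero_list_def)


section \<open>Two-sided ideals\<close>

definition two_sided_ideal :: "'a::ring_1 set \<Rightarrow> bool"
  where "two_sided_ideal I \<longleftrightarrow>
    0 \<in> I \<and> (\<forall>a\<in>I. \<forall>b\<in>I. a + b \<in> I) \<and> (\<forall>a\<in>I. \<forall>r. r * a \<in> I \<and> a * r \<in> I)"

lemma two_sided_ideal_hull: "two_sided_ideal (two_sided_ideal hull S)"
  by (rule hull_in) (auto simp: two_sided_ideal_def)

lemma two_sided_ideal_minus:
  assumes "two_sided_ideal I" "a \<in> I"
  shows "- a \<in> I"
proof -
  have "(- 1) * a \<in> I"
    using assms unfolding two_sided_ideal_def by blast
  then show ?thesis by simp
qed


section \<open>The algebra with generators x, y and relation xy - yx = y * y\<close>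

datatype gen = X | Y

definition jordan_ideal :: "(gen, 'k::field) free_algebra set"
  where "jordan_ideal = two_sided_ideal hull
    {free_var X * free_var Y - free_var Y * free_var X - (free_var Y)\<^sup>2}"

lemma jordan_ideal: "two_sided_ideal jordan_ideal"
  unfolding jordan_ideal_def by (rule two_sided_ideal_hull)

lemma jordan_ideal_0: "0 \<in> jordan_ideal"
  and jordan_ideal_add: "a \<in> jordan_ideal \<Longrightarrow> b \<in> jordan_ideal \<Longrightarrow> a + b \<in> jordan_ideal"
  and jordan_ideal_mult_left: "a \<in> jordan_ideal \<Longrightarrow> r * a \<in> jordan_ideal"
  and jordan_ideal_mult_right: "a \<in> jordan_ideal \<Longrightarrow> a * r \<in> jordan_ideal"
  using jordan_ideal unfolding two_sided_ideal_def by blast+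

lemma jordan_ideal_minus: "a \<in> jordan_ideal \<Longrightarrow> - a \<in> jordan_ideal"
  by (rule two_sided_ideal_minus[OF jordan_ideal])

definition jordan_rel :: "(gen, 'k::field) free_algebra \<Rightarrow> (gen, 'k) free_algebra \<Rightarrow> bool"
  where "jordan_rel a b \<longleftrightarrow> a - b \<in> jordan_ideal"

quotient_type (overloaded) 'k jordan_plane = "(gen, 'k::field) free_algebra" / jordan_rel
proof (rule equivpI)
  show "reflp jordan_rel"
    by (simp add: reflp_def jordan_rel_def jordan_ideal_0)
  show "symp jordan_rel"
    unfolding symp_def jordan_rel_def by (metis jordan_ideal_minus minus_diff_eq)
  show "transp jordan_rel"
    unfolding transp_def jordan_rel_def
    by (metis jordan_ideal_add diff_add_cancel add_diff_eq)
qed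

instantiation jordan_plane :: (field) ring_1
begin

lift_definition zero_jordan_plane :: "'a jordan_plane" is 0 .

lift_definition one_jordan_plane :: "'a jordan_plane" is 1 .

lift_definition plus_jordan_plane :: "'a jordan_plane \<Rightarrow> 'a jordan_plane \<Rightarrow> 'a jordan_plane"
  is "(+)"
  unfolding jordan_rel_def by (metis jordan_ideal_add add_diff_add)

lift_definition uminus_jordan_plane :: "'a jordan_plane \<Rightarrow> 'a jordan_plane"
  is uminus
  unfolding jordan_rel_def by (metis jordan_ideal_minus minus_diff_minus)

lift_definition minus_jordan_plane :: "'a jordan_plane \<Rightarrow> 'a jordan_plane \<Rightarrow> 'a jordan_plane"
  is "(-)"
  unfolding jordan_rel_def
  by (metis (no_types, lifting) jordan_ideal_add jordan_ideal_minus add_diff_add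
      minus_diff_minus diff_conv_add_uminus)

lift_definition times_jordan_plane :: "'a jordan_plane \<Rightarrow> 'a jordan_plane \<Rightarrow> 'a jordan_plane"
  is "(*)"
proof -
  fix a b c d :: "(gen, 'a) free_algebra"
  assume "jordan_rel a b" "jordan_rel c d"
  then have "(a - b) * c + b * (c - d) \<in> jordan_ideal"
    by (intro jordan_ideal_add jordan_ideal_mult_left jordan_ideal_mult_right)
      (simp_all add: jordan_rel_def)
  also have "(a - b) * c + b * (c - d) = a * c - b * d"
    by (simp add: algebra_simps)
  finally show "jordan_rel (a * c) (b * d)"
    by (simp add: jordan_rel_def)
qed

lemma one_notin_jordan_ideal: "(1 :: (gen, 'a) free_algebra) \<notin> jordan_ideal"
proof
  let ?J = "{f :: (gen, 'a) free_algebra. Poly_Mapping.lookup f [] = 0}"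
  have mult: "Poly_Mapping.lookup (f * g) [] = Poly_Mapping.lookup f [] * Poly_Mapping.lookup g []"
    for f g :: "(gen, 'a) free_algebra"
  proof -
    have "Sum_any (\<lambda>q. Poly_Mapping.lookup g q when [] = l + q) = (Poly_Mapping.lookup g [] when l = [])"
      for l :: "gen list"
      by (cases l) (simp_all add: plus_list_def)
    then have "Poly_Mapping.lookup (f * g) []
        = Sum_any (\<lambda>l. Poly_Mapping.lookup f l * (Poly_Mapping.lookup g [] when l = []))"
      by (simp add: lookup_mult)
    also have "(\<lambda>l. Poly_Mapping.lookup f l * (Poly_Mapping.lookup g [] when l = []))
        = (\<lambda>l. (Poly_Mapping.lookup f [] * Poly_Mapping.lookup g []) when l = [])"
      by (rule ext) (simp add: when_def)
    finally show ?thesis by simp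
  qed
  have "two_sided_ideal ?J"
    by (auto simp: two_sided_ideal_def mult lookup_add)
  moreover have "free_var X * free_var Y - free_var Y * free_var X - (free_var Y)\<^sup>2 \<in> ?J"
    by (simp add: lookup_minus mult power2_eq_square) (simp add: free_var_def lookup_single)
  ultimately have "jordan_ideal \<subseteq> ?J"
    unfolding jordan_ideal_def by (intro hull_minimal) auto
  moreover assume "(1 :: (gen, 'a) free_algebra) \<in> jordan_ideal"
  ultimately have "Poly_Mapping.lookup (1 :: (gen, 'a) free_algebra) [] = 0"
    by blast
  then show False
    by (simp add: lookup_one flip: zero_list_def)
qed

instance
proof
  show "(0 :: 'a jordan_plane) \<noteq> 1"
    by transfer (metis jordan_rel_def one_notin_jordan_ideal jordan_ideal_minus
        diff_0 minus_minus)
qed (transfer; simp add: jordan_rel_def jordan_ideal_0 algebra_simps)+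

end

lift_definition jordan_var :: "gen \<Rightarrow> 'k::field jordan_plane" is free_var .

lift_definition jordan_scale :: "'k::field \<Rightarrow> 'k jordan_plane \<Rightarrow> 'k jordan_plane"
  is "\<lambda>c a. free_const c * a"
  unfolding jordan_rel_def by (metis jordan_ideal_mult_left right_diff_distrib)

lemma jordan_relation:
  "jordan_var X * jordan_var Y - jordan_var Y * jordan_var X = (jordan_var Y)\<^sup>2"
  unfolding power2_eq_square
  by transfer (simp add: jordan_rel_def jordan_ideal_def hull_inc power2_eq_square)

lemma vector_space_jordan_scale: "vector_space jordan_scale"
  by standard
    (transfer; simp add: jordan_rel_def jordan_ideal_0 free_const_add free_const_mult
      free_const_1 algebra_simps)+

definition eval_poly ::
    "('k::zero \<Rightarrow> 'r \<Rightarrow> 'r) \<Rightarrow> 'k poly \<Rightarrow> 'r::semiring_1 \<Rightarrow> 'r"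
  where "eval_poly scale p a = (\<Sum>i\<le>degree p. scale (coeff p i) (a ^ i))"


section \<open>Automorphism groups and semidirect products\<close>

definition algebra_automorphism :: "('k \<Rightarrow> 'r \<Rightarrow> 'r) \<Rightarrow> ('r::ring_1 \<Rightarrow> 'r) \<Rightarrow> bool"
  where "algebra_automorphism scale f \<longleftrightarrow>
    bij f \<and> f 1 = 1 \<and> (\<forall>a b. f (a + b) = f a + f b) \<and> (\<forall>a b. f (a * b) = f a * f b) \<and>
    (\<forall>c a. f (scale c a) = scale c (f a))"

definition algebra_Aut :: "('k \<Rightarrow> 'r \<Rightarrow> 'r) \<Rightarrow> ('r::ring_1 \<Rightarrow> 'r) monoid"
  where "algebra_Aut scale =
    \<lparr>carrier = {f. algebra_automorphism scale f}, mult = (\<circ>), one = id\<rparr>"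

lemma group_algebra_Aut: "group (algebra_Aut scale)"
proof (rule groupI)
  fix f assume "f \<in> carrier (algebra_Aut scale)"
  then have f: "algebra_automorphism scale f" by (simp add: algebra_Aut_def)
  then have bij: "bij f" by (simp add: algebra_automorphism_def)
  have fi: "f (inv_into UNIV f z) = z" for z
    using bij by (simp add: bij_is_surj surj_f_inv_f)
  have eqI: "inv_into UNIV f u = v" if "u = f v" for u v
    using bij that by (simp add: bij_is_inj)
  have "algebra_automorphism scale (inv_into UNIV f)"
    using f unfolding algebra_automorphism_def
    by (auto intro!: eqI simp: bij_imp_bij_inv fi)
  moreover have "inv_into UNIV f \<circ> f = id"
    using bij by (simp add: bij_is_inj)
  ultimately show "\<exists>g\<in>carrier (algebra_Aut scale).
      g \<otimes>\<^bsub>algebra_Aut scale\<^esub> f = \<one>\<^bsub>algebra_Aut scale\<^esub>"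
    by (auto simp: algebra_Aut_def)
qed (auto simp: algebra_Aut_def algebra_automorphism_def bij_comp)

definition additive_group :: "'a::ab_group_add monoid"
  where "additive_group = \<lparr>carrier = UNIV, mult = (+), one = 0\<rparr>"

definition multiplicative_group :: "'a::field monoid"
  where "multiplicative_group = \<lparr>carrier = UNIV - {0}, mult = (*), one = 1\<rparr>"

lemma group_additive_group: "group additive_group"
  by (rule groupI) (auto simp: additive_group_def add.assoc intro: exI[of _ "- x" for x])

lemma group_multiplicative_group: "group multiplicative_group"
proof (rule groupI)
  fix x :: 'a assume "x \<in> carrier multiplicative_group"
  then show "\<exists>y\<in>carrier multiplicative_group.
      y \<otimes>\<^bsub>multiplicative_group\<^esub> x = \<one>\<^bsub>multiplicative_group\<^esub>"
    by (intro bexI[of _ "inverse x"]) (auto simp: multiplicative_group_def)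
qed (auto simp: multiplicative_group_def)

text \<open>
  The outer semidirect product with normal factor \<open>N\<close>; it is meant to be used with
  \<open>\<theta> \<in> hom H (AutoGroup N)\<close>.
\<close>

definition semidirect_product ::
    "('n, 'p) monoid_scheme \<Rightarrow> ('h, 'q) monoid_scheme \<Rightarrow> ('h \<Rightarrow> 'n \<Rightarrow> 'n) \<Rightarrow> ('n \<times> 'h) monoid"
  where "semidirect_product N H \<theta> =
    \<lparr>carrier = carrier N \<times> carrier H,
     mult = (\<lambda>(n, h) (n', h'). (n \<otimes>\<^bsub>N\<^esub> \<theta> h n', h \<otimes>\<^bsub>H\<^esub> h')),
     one = (\<one>\<^bsub>N\<^esub>, \<one>\<^bsub>H\<^esub>)\<rparr>"

end

theory Submission
  imports Defs
begin

text \<open>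
  Since \<open>xy = y(x + y)\<close>, every element of the algebra \<open>R\<close> is a sum of terms \<open>p\<^sub>j(y) x\<^sup>j\<close>. These terms
  are independent because \<open>R\<close> is the Ore extension \<open>k[y][x; \<delta>]\<close> with \<open>\<delta> = y\<^sup>2 d/dy\<close>: the
  multiplication of the Ore extension can be written down on the polynomials in \<open>x\<close> over \<open>k[y]\<close>, its
  \<open>x\<close> and \<open>y\<close> satisfy the relation, and so \<open>R\<close> maps to it (\<open>jordan_symbol\<close>). Rewriting a
  symbol as a sum of terms \<open>p\<^sub>j(y) x\<^sup>j\<close> undoes this map (\<open>jordan_normal_form_symbol\<close>).
  In the Ore extension the degrees in \<open>x\<close> add and the leading coefficients multiply, so the units of
  \<open>R\<close> are scalars and \<open>y\<close> can be cancelled. Moreover \<open>[f, y]\<close> has leading term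
  \<open>n y\<^sup>2 p\<^sub>n(y) x\<^sup>n\<^sup>-\<^sup>1\<close> for \<open>f\<close> of degree \<open>n\<close>, so in characteristic 0 the centralizer of \<open>y\<close> is
  \<open>k[y]\<close>.

  Let \<open>h\<close> be an automorphism. Modulo \<open>y\<close> the algebra becomes \<open>k[x]\<close>, which is commutative and has no
  nilpotents; the relation between \<open>h(x)\<close> and \<open>h(y)\<close> thus makes the square of \<open>h(y)\<close>, and then
  \<open>h(y)\<close> itself, vanish there, so \<open>h(y) = yu\<close>. Likewise the preimage of \<open>y\<close> is some \<open>yv\<close>. Hence
  \<open>y = h(y) h(v) = y u h(v)\<close>, which makes \<open>u\<close> a unit and therefore a scalar \<open>\<alpha> \<noteq> 0\<close>. The relation
  now reads \<open>[h(x), y] = \<alpha> y\<^sup>2 = [\<alpha> x, y]\<close>, so \<open>h(x) - \<alpha> x\<close> commutes with \<open>y\<close> and is a polynomial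
  in \<open>y\<close> (\<open>jordan_automorphism_triangular\<close>).

  Conversely, the images \<open>\<alpha> x + p(y)\<close> and \<open>\<alpha> y\<close> satisfy the relation and define an endomorphism. The
  pairs \<open>(\<alpha>, p)\<close> and \<open>(\<beta>, q)\<close> compose to \<open>(\<alpha>\<beta>, \<beta> p + q(\<alpha> y))\<close>, which gives the inverse and,
  after passing from \<open>p\<close> to \<open>n = p/\<alpha>\<close>, the semidirect product in which \<open>\<alpha>\<close> acts on \<open>k[y]\<close> by
  \<open>n(y) \<mapsto> n(\<alpha> y)/\<alpha>\<close>.
\<close>

section \<open>The Ore extension of k[y] by the derivation y*y d/dy\<close>

definition ore_deriv :: "'k::field poly \<Rightarrow> 'k poly"
  where "ore_deriv p = [:0, 0, 1:] * pderiv p"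

lemma ore_deriv_0 [simp]: "ore_deriv 0 = 0"
  by (simp add: ore_deriv_def)

lemma ore_deriv_add: "ore_deriv (p + q) = ore_deriv p + ore_deriv q"
  by (simp add: ore_deriv_def pderiv_add algebra_simps)

lemma ore_deriv_mult: "ore_deriv (p * q) = p * ore_deriv q + ore_deriv p * q"
  by (simp add: ore_deriv_def pderiv_mult algebra_simps)

text \<open>
  The outer variable of a \<^typ>\<open>'k poly poly\<close> plays the role of \<open>x\<close>, the inner one that of \<open>y\<close>.
  Since \<open>xp = px + \<delta>(p)\<close> for \<open>p\<close> in \<open>k[y]\<close>, the following is multiplication by \<open>x\<close> from the left.
\<close>

definition ore_X_mult :: "'k::field poly poly \<Rightarrow> 'k poly poly"
  where "ore_X_mult f = pCons 0 f + map_poly ore_deriv f"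

lemma coeff_ore_X_mult:
  "coeff (ore_X_mult f) n = (case n of 0 \<Rightarrow> 0 | Suc m \<Rightarrow> coeff f m) + ore_deriv (coeff f n)"
  by (simp add: ore_X_mult_def coeff_map_poly coeff_pCons split: nat.split)

lemma ore_X_mult_0 [simp]: "ore_X_mult 0 = 0"
  by (simp add: ore_X_mult_def)

lemma ore_X_mult_add: "ore_X_mult (f + g) = ore_X_mult f + ore_X_mult g"
  by (rule poly_eqI) (simp add: coeff_ore_X_mult ore_deriv_add split: nat.split)

lemma ore_X_mult_smult: "ore_X_mult (smult p f) = smult p (ore_X_mult f) + smult (ore_deriv p) f"
  by (rule poly_eqI) (simp add: coeff_ore_X_mult ore_deriv_mult algebra_simps split: nat.split)

lemma ore_X_mult_pCons: "ore_X_mult (pCons p f) = [:ore_deriv p:] + pCons 0 (ore_X_mult f) + [:0, p:]"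
  by (rule poly_eqI) (simp add: coeff_ore_X_mult coeff_pCons split: nat.split)

text \<open>
  An element \<open>\<Sum> p\<^sub>j x\<^sup>j\<close> acts from the left as \<open>\<Sum> p\<^sub>j D\<^sup>j\<close>, where \<open>D\<close> is the left action of \<open>x\<close>.
\<close>

definition ore_mult :: "'k::field poly poly \<Rightarrow> 'k poly poly \<Rightarrow> 'k poly poly"
  where "ore_mult f = fold_coeffs (\<lambda>p h g. smult p g + h (ore_X_mult g)) f (\<lambda>_. 0)"

lemma ore_mult_0_left [simp]: "ore_mult 0 g = 0"
  by (simp add: ore_mult_def)

lemma ore_mult_pCons_left: "ore_mult (pCons p f) g = smult p g + ore_mult f (ore_X_mult g)"
proof (cases "p = 0 \<and> f = 0")
  case False
  then have "fold_coeffs (\<lambda>p h g. smult p g + h (ore_X_mult g)) (pCons p f) =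
      (\<lambda>h g. smult p g + h (ore_X_mult g)) \<circ> fold_coeffs (\<lambda>p h g. smult p g + h (ore_X_mult g)) f"
    by (intro ext) (auto simp: fold_coeffs_pCons_coeff_not_0_eq)
  then show ?thesis
    by (simp add: ore_mult_def)
qed simp

lemma ore_mult_0_right [simp]: "ore_mult f 0 = 0"
  by (induction f) (simp_all add: ore_mult_pCons_left)

lemma ore_mult_const_left [simp]: "ore_mult [:p:] g = smult p g"
  by (simp add: ore_mult_pCons_left)

lemma ore_mult_add_left: "ore_mult (f + g) h = ore_mult f h + ore_mult g h"
  by (induction f g arbitrary: h rule: poly_induct2)
    (simp_all add: ore_mult_pCons_left smult_add_left algebra_simps)

lemma ore_mult_add_right: "ore_mult f (g + h) = ore_mult f g + ore_mult f h"
  by (induction f arbitrary: g h)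
    (simp_all add: ore_mult_pCons_left smult_add_right ore_X_mult_add algebra_simps)

lemma ore_mult_smult_left: "ore_mult (smult p f) g = smult p (ore_mult f g)"
  by (induction f arbitrary: g) (simp_all add: ore_mult_pCons_left smult_add_right)

text \<open>
  The product rule for \<open>\<delta>\<close> is exactly what associativity needs when the left factor is \<open>x\<close>. Since
  \<open>x\<close> and the scalars from \<open>k[y]\<close> generate everything from the left, associativity follows.
\<close>

lemma ore_mult_X_left_assoc: "ore_mult (ore_X_mult f) g = ore_X_mult (ore_mult f g)"
  by (induction f arbitrary: g)
    (simp_all add: ore_mult_pCons_left ore_X_mult_pCons ore_X_mult_add ore_X_mult_smult ore_mult_add_left)

lemma ore_mult_assoc: "ore_mult (ore_mult f g) h = ore_mult f (ore_mult g h)"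
  by (induction f arbitrary: g)
    (simp_all add: ore_mult_pCons_left ore_mult_add_left ore_mult_smult_left ore_mult_X_left_assoc)

lemma ore_X_mult_const: "ore_X_mult [:p:] = [:ore_deriv p, p:]"
  by (simp add: ore_X_mult_pCons)

lemma ore_mult_1_right [simp]: "ore_mult f 1 = f"
proof -
  have shift: "ore_mult g (pCons 0 h) = pCons 0 (ore_mult g h)" for g h :: "'a poly poly"
    by (induction g arbitrary: h) (simp_all add: ore_mult_pCons_left ore_X_mult_pCons)
  have "ore_X_mult (1 :: 'a poly poly) = pCons 0 1"
    by (simp add: ore_X_mult_const ore_deriv_def pderiv_1 flip: pCons_one)
  then show ?thesis
    by (induction f) (simp_all add: ore_mult_pCons_left shift smult_one)
qed

lemma ore_mult_1_left [simp]: "ore_mult 1 g = g"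
  using ore_mult_const_left[of 1 g] by (simp add: pCons_one)

text \<open>
  A copy of the type, since iterated polynomials already carry their commutative product.
\<close>

typedef (overloaded) 'k ore = "UNIV :: 'k::field poly poly set"
  morphisms ore_coeffs Ore by simp

setup_lifting type_definition_ore

instantiation ore :: (field) ring_1
begin

lift_definition zero_ore :: "'a ore" is 0 .
lift_definition one_ore :: "'a ore" is 1 .
lift_definition plus_ore :: "'a ore \<Rightarrow> 'a ore \<Rightarrow> 'a ore" is "(+)" .
lift_definition minus_ore :: "'a ore \<Rightarrow> 'a ore \<Rightarrow> 'a ore" is "(-)" .
lift_definition uminus_ore :: "'a ore \<Rightarrow> 'a ore" is uminus .
lift_definition times_ore :: "'a ore \<Rightarrow> 'a ore \<Rightarrow> 'a ore" is ore_mult .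

instance
proof
  fix a b c :: "'a ore"
  show "1 * a = a"
    by transfer (rule ore_mult_1_left)
qed (transfer; simp add: ore_mult_assoc ore_mult_add_left ore_mult_add_right)+

end

text \<open>
  Applying \<open>\<delta>\<close> to coefficients does not raise the degree in \<open>x\<close>, so \<open>x\<close> acts on leading terms like
  the variable of a commutative polynomial ring. Bounds on the degrees in place of the degrees themselves
  keep the induction free of cases where leading terms vanish.
\<close>

lemma ore_mult_leading:
  assumes "degree f \<le> m" "degree g \<le> n"
  shows "degree (ore_mult f g) \<le> m + n"
    and "coeff (ore_mult f g) (m + n) = coeff f m * coeff g n"
proof -
  have "degree (ore_mult f g) \<le> m + n \<and> coeff (ore_mult f g) (m + n) = coeff f m * coeff g n"
    using assms
  proof (induction m arbitrary: f g n)
    case 0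
    then obtain p where "f = [:p:]"
      by (metis degree_eq_zeroE le_zero_eq)
    with 0 show ?case
      by (auto intro: order.trans[OF degree_smult_le])
  next
    case (Suc m)
    obtain p q where f: "f = pCons p q"
      by (rule pCons_cases)
    have q: "degree q \<le> m"
      using Suc.prems f by (auto split: if_splits)
    have D: "degree (ore_X_mult g) \<le> Suc n" "coeff (ore_X_mult g) (Suc n) = coeff g n"
      using Suc.prems(2) by (auto intro!: degree_le simp: coeff_ore_X_mult coeff_eq_0 split: nat.split)
    have "degree (smult p g) \<le> n"
      using Suc.prems(2) by (meson degree_smult_le order.trans)
    with Suc.IH[OF q D(1)] D(2) Suc.prems(2) show ?case
      by (auto simp: f ore_mult_pCons_left coeff_eq_0 intro!: degree_add_le)
  qed
  then show "degree (ore_mult f g) \<le> m + n"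
    and "coeff (ore_mult f g) (m + n) = coeff f m * coeff g n" by auto
qed

lemma ore_X_mult_smult_Y:
  "ore_X_mult (smult [:0, 1:] g) = smult [:0, 1:] (ore_X_mult g) + smult [:0, 0, 1:] g"
  by (simp add: ore_X_mult_smult ore_deriv_def pderiv_pCons)

text \<open>
  Each \<open>x\<close> that passes a \<open>y\<close> leaves one summand \<open>y\<^sup>2\<close> of degree one less in \<open>x\<close>, and a term of
  degree \<open>m + 1\<close> has \<open>m + 1\<close> such passages. The right factor \<open>g\<close> is needed for the induction on \<open>f\<close>,
  which turns \<open>g\<close> into \<open>xg\<close>.
\<close>

lemma ore_mult_commutator_leading:
  assumes "degree f \<le> Suc m" "degree g \<le> n"
  shows "coeff (ore_mult f (smult [:0, 1:] g) - smult [:0, 1:] (ore_mult f g)) (m + n) =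
    of_nat (Suc m) * [:0, 0, 1:] * coeff f (Suc m) * coeff g n"
  using assms
proof (induction m arbitrary: f g n)
  case 0
  obtain p r where f: "f = pCons p r"
    by (rule pCons_cases)
  with 0 have "degree r = 0"
    by (auto split: if_splits)
  then obtain q where "r = [:q:]"
    by (rule degree_eq_zeroE)
  then have "ore_mult f (smult [:0, 1:] g) - smult [:0, 1:] (ore_mult f g) =
      smult ([:0, 0, 1:] * q) g"
    by (simp only: f ore_mult_pCons_left ore_mult_0_left ore_X_mult_smult_Y smult_add_right
        smult_smult mult.commute add_0_right) (simp add: algebra_simps)
  then show ?case
    by (simp only: f \<open>r = [:q:]\<close> coeff_smult coeff_pCons_Suc coeff_pCons_0 add_0 add_0_right
        of_nat_Suc of_nat_0 mult_1_left)
next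
  case (Suc m)
  obtain p q where f: "f = pCons p q"
    by (rule pCons_cases)
  have q: "degree q \<le> Suc m"
    using Suc.prems f by (auto split: if_splits)
  have Dg: "degree (ore_X_mult g) \<le> Suc n" "coeff (ore_X_mult g) (Suc n) = coeff g n"
    using Suc.prems(2) by (auto intro!: degree_le simp: coeff_ore_X_mult coeff_eq_0 split: nat.split)
  have "degree (smult [:0, 0, 1:] g) \<le> n"
    using Suc.prems(2) by (meson degree_smult_le order.trans)
  from ore_mult_leading(2)[OF q this]
  have lead: "coeff (ore_mult q (smult [:0, 0, 1:] g)) (Suc m + n) =
      [:0, 0, 1:] * coeff q (Suc m) * coeff g n"
    by (simp only: coeff_smult mult_ac)
  have "ore_mult f (smult [:0, 1:] g) - smult [:0, 1:] (ore_mult f g) =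
      (ore_mult q (smult [:0, 1:] (ore_X_mult g)) - smult [:0, 1:] (ore_mult q (ore_X_mult g)))
      + ore_mult q (smult [:0, 0, 1:] g)"
    unfolding f ore_mult_pCons_left ore_X_mult_smult_Y ore_mult_add_right smult_add_right smult_smult
    by (simp only: mult.commute[of p]) (simp only: diff_conv_add_uminus minus_add_distrib add_ac
      add.right_inverse add.left_inverse add_0_right add_0_left minus_add_cancel add_minus_cancel)
  then have "coeff (ore_mult f (smult [:0, 1:] g) - smult [:0, 1:] (ore_mult f g)) (Suc m + n) =
      coeff (ore_mult q (smult [:0, 1:] (ore_X_mult g)) - smult [:0, 1:] (ore_mult q (ore_X_mult g)))
        (m + Suc n)
      + coeff (ore_mult q (smult [:0, 0, 1:] g)) (Suc m + n)"
    by (simp only: coeff_add add_Suc_shift)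
  also have "\<dots> = of_nat (Suc m) * [:0, 0, 1:] * coeff q (Suc m) * coeff g n
      + [:0, 0, 1:] * coeff q (Suc m) * coeff g n"
    by (simp only: Suc.IH[OF q Dg(1)] Dg(2) lead)
  finally show ?case
    by (simp only: f coeff_pCons_Suc of_nat_Suc[of "Suc m"] distrib_right mult_1_left add.commute)
qed

lemma ore_degree_0_of_mult_1:
  assumes "ore_mult f g = 1"
  shows "degree f = 0"
proof -
  have "f \<noteq> 0" "g \<noteq> 0"
    using assms by auto
  then have "coeff (ore_mult f g) (degree f + degree g) \<noteq> 0"
    by (simp add: ore_mult_leading(2))
  then have "degree f + degree g \<le> degree (1 :: 'a poly poly)"
    unfolding assms by (rule le_degree)
  then show ?thesis
    by simp
qed

lemma ore_centralizer_Y: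
  fixes f :: "'k::field_char_0 poly poly"
  assumes "ore_mult f [:[:0, 1:]:] = smult [:0, 1:] f"
  shows "degree f = 0"
proof (rule ccontr)
  assume "degree f \<noteq> 0"
  then obtain m where m: "degree f = Suc m"
    using not0_implies_Suc by blast
  have "coeff (ore_mult f (smult [:0, 1:] 1) - smult [:0, 1:] (ore_mult f 1)) (m + 0) =
      of_nat (Suc m) * [:0, 0, 1:] * coeff f (Suc m) * coeff 1 0"
    by (rule ore_mult_commutator_leading) (simp_all add: m)
  moreover have "smult [:0, 1:] 1 = [:[:0, 1:] :: 'k poly:]"
    by (simp add: one_pCons)
  ultimately have "of_nat (Suc m) * [:0, 0, 1:] * coeff f (Suc m) = 0"
    using assms by simp
  moreover have "coeff f (Suc m) \<noteq> 0"
    using m by (metis leading_coeff_0_iff degree_0 nat.simps(3))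
  moreover have "of_nat (Suc m) \<noteq> (0 :: 'k poly)"
    using of_nat_neq_0 by blast
  ultimately show False
    by simp
qed

section \<open>The universal property of the Jordan plane\<close>

text \<open>
  A \<open>k\<close>-algebra structure, given by the images of the scalars. The target algebras are
  \<open>k[x]\<close>, the Ore extension and \<open>R\<close> itself.
\<close>

locale central_scalars =
  fixes c :: "'k::field \<Rightarrow> 'r::ring_1"
  assumes c_1: "c 1 = 1"
    and c_add: "c (a + b) = c a + c b"
    and c_mult: "c (a * b) = c a * c b"
    and c_central: "c a * r = r * c a"
begin

lemma c_0: "c 0 = 0"
  using c_add[of 0 0] by simp

definition free_lift :: "('g \<Rightarrow> 'r) \<Rightarrow> ('g, 'k) free_algebra \<Rightarrow> 'r"
  where "free_lift v f = (\<Sum>w\<in>Poly_Mapping.keys f. c (Poly_Mapping.lookup f w) * prod_list (map v w))"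

lemma free_lift_superset:
  assumes "finite S" "Poly_Mapping.keys f \<subseteq> S"
  shows "free_lift v f = (\<Sum>w\<in>S. c (Poly_Mapping.lookup f w) * prod_list (map v w))"
  unfolding free_lift_def using assms
  by (intro sum.mono_neutral_left) (auto simp: c_0 in_keys_iff)

lemma free_lift_add: "free_lift v (f + g) = free_lift v f + free_lift v g"
  using Poly_Mapping.keys_add[of f g]
  by (simp add: free_lift_superset[of "Poly_Mapping.keys f \<union> Poly_Mapping.keys g"] lookup_add c_add
      distrib_right sum.distrib)

lemma free_lift_single: "free_lift v (Poly_Mapping.single w a) = c a * prod_list (map v w)"
  by (simp add: free_lift_superset[of "{w}"] lookup_single)

lemma free_lift_1: "free_lift v 1 = 1"
  using free_lift_single[of v 0 1] by (simp add: c_1 zero_list_def flip: single_one)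

end

lemma free_algebra_induct [case_names single add]:
  fixes f :: "('g, 'k::monoid_add) free_algebra"
  assumes single: "\<And>w a. P (Poly_Mapping.single w a)"
    and add: "\<And>f g. P f \<Longrightarrow> P g \<Longrightarrow> P (f + g)"
  shows "P f"
proof (induction f rule: Poly_Mapping.update_induct)
  case const
  show ?case
    using single[of "[]" 0] by simp
next
  case (update f a b)
  then have "Poly_Mapping.update a b f = f + Poly_Mapping.single a b"
    by (intro poly_mapping_eqI)
      (auto simp: lookup_add lookup_single lookup_update in_keys_iff when_def)
  then show ?case
    using update single add by simp
qed

context central_scalars
begin

lemma free_lift_mult: "free_lift v (f * g) = free_lift v f * free_lift v g"
proof (induction f rule: free_algebra_induct)
  case (single u a)
  show ?case
  proof (induction g rule: free_algebra_induct)
    case (single w b)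
    have "c a * c b * (r * s) = c a * r * (c b * s)" for r s
      by (simp add: mult.assoc) (metis c_central mult.assoc)
    then show ?case
      by (simp add: mult_single free_lift_single c_mult plus_list_def)
  qed (simp add: distrib_left free_lift_add)
qed (simp add: distrib_right free_lift_add)

end

definition jordan_hom :: "('k::field \<Rightarrow> 'r::ring_1) \<Rightarrow> ('k jordan_plane \<Rightarrow> 'r) \<Rightarrow> bool"
  where "jordan_hom c h \<longleftrightarrow> h 1 = 1 \<and> (\<forall>a b. h (a + b) = h a + h b) \<and>
    (\<forall>a b. h (a * b) = h a * h b) \<and> (\<forall>k a. h (jordan_scale k a) = c k * h a)"

lemma jordan_homD:
  assumes "jordan_hom c h"
  shows "h 1 = 1" "h (a + b) = h a + h b" "h (a * b) = h a * h b"
    "h (jordan_scale k a) = c k * h a" "h 0 = 0" "h (- a) = - h a" "h (a - b) = h a - h b"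
proof -
  show add: "h (a + b) = h a + h b" for a b
    using assms by (simp add: jordan_hom_def)
  show zero: "h 0 = 0"
    using add[of 0 0] by simp
  show minus: "h (- a) = - h a" for a
    using add[of "- a" a] zero by (simp add: eq_neg_iff_add_eq_0)
  show "h (a - b) = h a - h b"
    using add[of a "- b"] minus[of b] by simp
qed (use assms in \<open>simp_all add: jordan_hom_def\<close>)

text \<open>
  The kernel of an evaluation of words is a two-sided ideal, so it contains the ideal of relations as soon
  as it contains the relation itself.
\<close>

theorem jordan_plane_universal:
  assumes c: "central_scalars c" and rel: "x * y - y * x = y\<^sup>2"
  obtains h where "jordan_hom c h" "h (jordan_var X) = x" "h (jordan_var Y) = y"
proof -
  interpret central_scalars c by (rule c)
  let ?v = "case_gen x y"
  have minus: "free_lift ?v (f - g) = free_lift ?v f - free_lift ?v g" for f g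
    using free_lift_add[of ?v "f - g" g] by simp
  have "jordan_ideal \<subseteq> {f. free_lift ?v f = 0}"
    unfolding jordan_ideal_def
  proof (rule hull_minimal)
    show "two_sided_ideal {f. free_lift ?v f = 0}"
      using free_lift_single[of ?v "[]" 0]
      by (auto simp: two_sided_ideal_def free_lift_add free_lift_mult c_0)
    show "{free_var X * free_var Y - free_var Y * free_var X - (free_var Y)\<^sup>2}
        \<subseteq> {f. free_lift ?v f = 0}"
      using rel
      by (simp add: minus free_lift_mult power2_eq_square free_var_def free_lift_single c_1)
  qed
  then have "free_lift ?v f = free_lift ?v g" if "jordan_rel f g" for f g
    using that minus[of f g] by (auto simp: jordan_rel_def)
  then have h: "free_lift ?v (rep_jordan_plane (abs_jordan_plane f)) = free_lift ?v f" for f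
    using Quotient_rep_abs[OF Quotient_jordan_plane, of f]
    by (metis jordan_plane.abs_eq_iff Quotient_abs_rep Quotient_jordan_plane)
  show thesis
  proof (rule that)
    show "jordan_hom c (\<lambda>r. free_lift ?v (rep_jordan_plane r))"
      unfolding jordan_hom_def
    proof (intro conjI allI)
      show "free_lift ?v (rep_jordan_plane 1) = 1"
        by (simp add: one_jordan_plane_def h free_lift_1)
      fix a b :: "'a jordan_plane" and k :: 'a
      obtain f g where ab: "a = abs_jordan_plane f" "b = abs_jordan_plane g"
        by (metis Quotient_abs_rep Quotient_jordan_plane)
      show "free_lift ?v (rep_jordan_plane (a + b)) =
          free_lift ?v (rep_jordan_plane a) + free_lift ?v (rep_jordan_plane b)"
        by (simp add: ab plus_jordan_plane.abs_eq h free_lift_add)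
      show "free_lift ?v (rep_jordan_plane (a * b)) =
          free_lift ?v (rep_jordan_plane a) * free_lift ?v (rep_jordan_plane b)"
        by (simp add: ab times_jordan_plane.abs_eq h free_lift_mult)
      show "free_lift ?v (rep_jordan_plane (jordan_scale k a)) =
          c k * free_lift ?v (rep_jordan_plane a)"
        by (simp add: ab jordan_scale.abs_eq h free_lift_mult free_const_def free_lift_single)
    qed
  qed (simp_all add: jordan_var_def h free_var_def free_lift_single c_1)
qed

interpretation jordan: vector_space jordan_scale
  by (rule vector_space_jordan_scale)

lemma jordan_scale_mult_left: "jordan_scale a (r * s) = jordan_scale a r * s"
  by transfer (simp add: jordan_rel_def jordan_ideal_0 mult.assoc)

lemma jordan_scale_mult_right: "jordan_scale a (r * s) = r * jordan_scale a s"
proof -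
  have "free_const a * f = f * free_const a" for f :: "(gen, 'a) free_algebra"
    by (induction f rule: free_algebra_induct)
      (simp_all add: free_const_def mult_single plus_list_def mult.commute distrib_left distrib_right)
  then show ?thesis
    by transfer (metis jordan_rel_def jordan_ideal_0 diff_self mult.assoc)
qed

lemma jordan_scale_eq_mult: "jordan_scale a r = jordan_scale a 1 * r"
  using jordan_scale_mult_left[of a 1 r] by simp

abbreviation jordan_const :: "'k::field \<Rightarrow> 'k jordan_plane"
  where "jordan_const a \<equiv> jordan_scale a 1"

lemma central_scalars_jordan: "central_scalars jordan_const"
proof
  show "jordan_const (a * b) = jordan_const a * jordan_const b" for a b :: 'a
    by (simp flip: jordan_scale_eq_mult)
  show "jordan_const a * r = r * jordan_const a" for a :: 'a and r
    using jordan_scale_mult_right[of a r 1] by (simp flip: jordan_scale_eq_mult)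
qed (simp_all add: jordan.scale_left_distrib)

text \<open>
  Words are built by multiplying with one variable at a time. Multiplication is from the left because
  that is the side on which \<open>x\<close> and \<open>y\<close> act on normal forms by a simple formula.
\<close>

lemma jordan_induct [case_names one add scale X Y]:
  fixes r :: "'k::field jordan_plane"
  assumes one: "P 1"
    and add: "\<And>r s. P r \<Longrightarrow> P s \<Longrightarrow> P (r + s)"
    and scale: "\<And>a r. P r \<Longrightarrow> P (jordan_scale a r)"
    and X: "\<And>r. P r \<Longrightarrow> P (jordan_var X * r)"
    and Y: "\<And>r. P r \<Longrightarrow> P (jordan_var Y * r)"
  shows "P r"
proof -
  have word: "P (abs_jordan_plane (Poly_Mapping.single w 1))" for w
  proof (induction w)
    case Nil
    then show ?case
      using one by (simp add: one_jordan_plane_def flip: single_one zero_list_def)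
  next
    case (Cons g w)
    have "abs_jordan_plane (Poly_Mapping.single (g # w) (1 :: 'k)) =
        jordan_var g * abs_jordan_plane (Poly_Mapping.single w 1)"
      by (simp add: jordan_var_def times_jordan_plane.abs_eq free_var_def mult_single plus_list_def)
    with Cons X Y show ?case
      by (cases g) simp_all
  qed
  have "P (abs_jordan_plane f)" for f
  proof (induction f rule: free_algebra_induct)
    case (single w a)
    have "abs_jordan_plane (Poly_Mapping.single w a) =
        jordan_scale a (abs_jordan_plane (Poly_Mapping.single w 1))"
      by (simp add: jordan_scale.abs_eq free_const_def mult_single plus_list_def)
    then show ?case
      using word scale by simp
  next
    case (add f g)
    then show ?case
      using assms(2) by (simp flip: plus_jordan_plane.abs_eq)
  qed
  then show ?thesis
    by (metis Quotient_abs_rep Quotient_jordan_plane)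
qed

lemma jordan_hom_eqI:
  assumes "jordan_hom c g" "jordan_hom c h"
    and "g (jordan_var X) = h (jordan_var X)" "g (jordan_var Y) = h (jordan_var Y)"
  shows "g = h"
proof
  show "g r = h r" for r
    using assms(3,4)
    by (induction r rule: jordan_induct)
      (simp_all add: jordan_homD[OF assms(1)] jordan_homD[OF assms(2)])
qed

lemma eval_poly_eq_sum:
  assumes "\<And>b. scale 0 b = 0" "degree p \<le> n"
  shows "eval_poly scale p x = (\<Sum>i\<le>n. scale (coeff p i) (x ^ i))"
  unfolding eval_poly_def using assms
  by (intro sum.mono_neutral_left) (auto simp: coeff_eq_0)

lemma eval_poly_0: "(\<And>b. scale 0 b = 0) \<Longrightarrow> eval_poly scale 0 x = 0"
  by (simp add: eval_poly_def)

lemma eval_poly_pCons: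
  assumes "\<And>b. scale 0 b = 0" "\<And>a b. scale a (b * x) = scale a b * x"
  shows "eval_poly scale (pCons a p) x = scale a 1 + eval_poly scale p x * x"
proof -
  have "eval_poly scale (pCons a p) x =
      (\<Sum>i\<le>Suc (degree p). scale (coeff (pCons a p) i) (x ^ i))"
    by (intro eval_poly_eq_sum assms degree_pCons_le)
  also have "\<dots> = scale a 1 + (\<Sum>i\<le>degree p. scale (coeff p i) (x ^ Suc i))"
    by (simp add: sum.atMost_Suc_shift del: power_Suc sum.atMost_Suc)
  also have "(\<Sum>i\<le>degree p. scale (coeff p i) (x ^ Suc i)) = eval_poly scale p x * x"
    by (simp add: eval_poly_def sum_distrib_right power_Suc2 assms(2) del: power_Suc)
  finally show ?thesis .
qed

lemma eval_poly_add:
  assumes "\<And>b. scale 0 b = 0" "\<And>a a' b. scale (a + a') b = scale a b + scale a' b"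
  shows "eval_poly scale (p + q) x = eval_poly scale p x + eval_poly scale q x"
proof -
  let ?n = "max (degree p) (degree q)"
  have "degree (p + q) \<le> ?n"
    by (rule degree_add_le_max)
  then show ?thesis
    using eval_poly_eq_sum[where n = ?n and scale = scale and x = x]
    by (simp add: assms sum.distrib)
qed

abbreviation jordan_eval :: "'k::field poly \<Rightarrow> 'k jordan_plane \<Rightarrow> 'k jordan_plane"
  where "jordan_eval \<equiv> eval_poly jordan_scale"

lemma jordan_eval_0 [simp]: "jordan_eval 0 r = 0"
  by (simp add: eval_poly_0)

lemma jordan_eval_pCons': "jordan_eval (pCons a p) r = jordan_const a + jordan_eval p r * r"
  by (simp add: eval_poly_pCons jordan_scale_mult_left)

lemma jordan_eval_add: "jordan_eval (p + q) r = jordan_eval p r + jordan_eval q r"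
  by (simp add: eval_poly_add jordan.scale_left_distrib)

lemma jordan_eval_smult: "jordan_eval (smult a p) r = jordan_scale a (jordan_eval p r)"
  by (induction p)
    (simp_all add: jordan_eval_pCons' jordan.scale_right_distrib jordan_scale_mult_left)

lemma jordan_eval_commute: "jordan_eval p r * r = r * jordan_eval p r"
proof (induction p)
  case (pCons a p)
  have "jordan_const a * r = r * jordan_const a"
    by (rule central_scalars.c_central[OF central_scalars_jordan])
  then show ?case
    by (simp add: jordan_eval_pCons' distrib_left distrib_right mult.assoc pCons.IH)
qed simp

lemma jordan_eval_pCons: "jordan_eval (pCons a p) r = jordan_const a + r * jordan_eval p r"
  by (simp add: jordan_eval_pCons' jordan_eval_commute)

text \<open>
  The shape of the hypothesis covers the endomorphisms of interest, which only scale \<open>y\<close>.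
\<close>

lemma jordan_hom_eval:
  assumes "jordan_hom jordan_const h" "h r = jordan_scale b s"
  shows "h (jordan_eval p r) = jordan_eval (pcompose p [:0, b:]) s"
proof (induction p)
  case (pCons a p)
  have "h (jordan_const a) = jordan_const a"
    using jordan_homD[OF assms(1)] by simp
  with pCons show ?case
    by (simp add: jordan_eval_pCons pcompose_pCons jordan_homD[OF assms(1)] assms(2)
      jordan_eval_add jordan_eval_smult jordan_scale_mult_right
      flip: jordan_scale_mult_left)
qed (simp add: jordan_homD[OF assms(1)])

section \<open>Normal forms in the Jordan plane\<close>

lift_definition ore_const :: "'k::field \<Rightarrow> 'k ore" is "\<lambda>a. [:[:a:]:]" .

lemma ore_mult_smult_const_right: "ore_mult f (smult [:a:] g) = smult [:a:] (ore_mult f g)"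
proof -
  have "ore_deriv [:a:] = 0"
    by (simp add: ore_deriv_def pderiv_pCons)
  then have "ore_X_mult (smult [:a:] g) = smult [:a:] (ore_X_mult g)" for g
    by (simp add: ore_X_mult_smult)
  then show ?thesis
    by (induction f arbitrary: g) (simp_all add: ore_mult_pCons_left smult_add_right mult.commute)
qed

lemma central_scalars_ore: "central_scalars ore_const"
proof
  show "ore_const a * r = r * ore_const a" for a :: 'a and r
  proof transfer
    fix a and f :: "'a poly poly"
    show "ore_mult [:[:a:]:] f = ore_mult f [:[:a:]:]"
      using ore_mult_smult_const_right[of f a 1] by (simp add: smult_one)
  qed
qed (transfer; simp add: one_pCons)+

lemma jordan_symbol_exists:
  "\<exists>h :: 'k::field jordan_plane \<Rightarrow> 'k ore. jordan_hom ore_const h \<and>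
    h (jordan_var X) = Ore [:0, 1:] \<and> h (jordan_var Y) = Ore [:[:0, 1:]:]"
proof -
  have "Ore [:0, 1:] * Ore [:[:0, 1:]:] - Ore [:[:0, 1:]:] * Ore [:0, 1:] = (Ore [:[:0, 1 :: 'k:]:])\<^sup>2"
    by (simp add: power2_eq_square times_ore.abs_eq minus_ore.abs_eq ore_mult_pCons_left
      ore_X_mult_const ore_deriv_def pderiv_pCons)
  with central_scalars_ore show ?thesis
    using jordan_plane_universal by metis
qed

text \<open>
  The representing polynomial of the image in the Ore extension, that is, the coefficients of the normal
  form \<open>\<Sum> p\<^sub>j(y) x\<^sup>j\<close>.
\<close>

definition jordan_symbol :: "'k::field jordan_plane \<Rightarrow> 'k poly poly"
  where "jordan_symbol r = ore_coeffs ((SOME h. jordan_hom ore_const h \<and>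
    h (jordan_var X) = Ore [:0, 1:] \<and> h (jordan_var Y) = Ore [:[:0, 1:]:]) r)"

lemma jordan_symbol_simps [simp]:
  fixes r s :: "'k::field jordan_plane"
  shows "jordan_symbol (0 :: 'k jordan_plane) = 0"
    and "jordan_symbol (1 :: 'k jordan_plane) = 1"
    and "jordan_symbol (r + s) = jordan_symbol r + jordan_symbol s"
    and "jordan_symbol (r * s) = ore_mult (jordan_symbol r) (jordan_symbol s)"
    and "jordan_symbol (jordan_scale a r) = smult [:a:] (jordan_symbol r)"
    and "jordan_symbol (jordan_var X) = ([:0, 1:] :: 'k poly poly)"
    and "jordan_symbol (jordan_var Y) = ([:[:0, 1:]:] :: 'k poly poly)"
proof -
  define h :: "'k jordan_plane \<Rightarrow> 'k ore" where "h = (SOME h. jordan_hom ore_const h \<and>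
    h (jordan_var X) = Ore [:0, 1:] \<and> h (jordan_var Y) = Ore [:[:0, 1:]:])"
  have h: "jordan_hom ore_const h" "h (jordan_var X) = Ore [:0, 1:]"
      "h (jordan_var Y) = Ore [:[:0, 1:]:]"
    using someI_ex[OF jordan_symbol_exists] unfolding h_def by blast+
  have s: "jordan_symbol r = ore_coeffs (h r)" for r
    by (simp add: jordan_symbol_def h_def)
  show "jordan_symbol (0 :: 'k jordan_plane) = 0"
    and "jordan_symbol (1 :: 'k jordan_plane) = 1"
    and "jordan_symbol (r + s) = jordan_symbol r + jordan_symbol s"
    and "jordan_symbol (r * s) = ore_mult (jordan_symbol r) (jordan_symbol s)"
    and "jordan_symbol (jordan_scale a r) = smult [:a:] (jordan_symbol r)"
    and "jordan_symbol (jordan_var X) = ([:0, 1:] :: 'k poly poly)"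
    and "jordan_symbol (jordan_var Y) = ([:[:0, 1:]:] :: 'k poly poly)"
    by (simp_all add: s h jordan_homD[OF h(1)] zero_ore.rep_eq one_ore.rep_eq plus_ore.rep_eq
      times_ore.rep_eq ore_const.rep_eq Ore_inverse)
qed

text \<open>
  The element \<open>\<Sum> p\<^sub>j(y) x\<^sup>j\<close>, obtained by evaluating an outer polynomial whose scalars
  \<open>p\<^sub>j\<close> act by multiplication with \<open>p\<^sub>j(y)\<close>.
\<close>

definition jordan_normal_form :: "'k::field poly poly \<Rightarrow> 'k jordan_plane"
  where "jordan_normal_form f =
    eval_poly (\<lambda>p r. jordan_eval p (jordan_var Y) * r) f (jordan_var X)"

lemma jordan_normal_form_0 [simp]: "jordan_normal_form 0 = 0"
  by (simp add: jordan_normal_form_def eval_poly_0)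

lemma jordan_normal_form_pCons [simp]:
  "jordan_normal_form (pCons p f) =
    jordan_eval p (jordan_var Y) + jordan_normal_form f * jordan_var X"
  by (simp add: jordan_normal_form_def eval_poly_pCons mult.assoc)

lemma jordan_normal_form_add:
  "jordan_normal_form (f + g) = jordan_normal_form f + jordan_normal_form g"
  by (simp add: jordan_normal_form_def eval_poly_add jordan_eval_add distrib_right)

lemma jordan_normal_form_smult_const:
  "jordan_normal_form (smult [:a:] f) = jordan_scale a (jordan_normal_form f)"
  by (induction f)
    (simp_all add: jordan_eval_smult jordan.scale_right_distrib jordan_scale_mult_left)

lemma jordan_normal_form_smult_Y:
  "jordan_normal_form (smult [:0, 1:] f) = jordan_var Y * jordan_normal_form f"
  by (induction f) (simp_all add: jordan_eval_pCons distrib_left mult.assoc)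

lemma jordan_XY: "jordan_var X * jordan_var Y = jordan_var Y * (jordan_var X + jordan_var Y)"
  using jordan_relation by (simp add: algebra_simps power2_eq_square)

lemma jordan_X_mult_eval_Y:
  "jordan_var X * jordan_eval p (jordan_var Y) =
    jordan_eval p (jordan_var Y) * jordan_var X + jordan_eval (ore_deriv p) (jordan_var Y)"
proof (induction p)
  case (pCons a p)
  let ?x = "jordan_var X :: 'a jordan_plane" and ?y = "jordan_var Y :: 'a jordan_plane"
  have d: "ore_deriv (pCons a p) = pCons 0 (pCons 0 p) + pCons 0 (ore_deriv p)"
    by (simp add: ore_deriv_def pderiv_pCons)
  have c: "?x * jordan_const a = jordan_const a * ?x"
    by (rule central_scalars.c_central[OF central_scalars_jordan, symmetric])
  have "?x * jordan_eval (pCons a p) ?y =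
      jordan_const a * ?x + (?x * ?y) * jordan_eval p ?y"
    by (simp add: jordan_eval_pCons distrib_left c mult.assoc)
  also have "(?x * ?y) * jordan_eval p ?y =
      ?y * (?x * jordan_eval p ?y) + ?y * (?y * jordan_eval p ?y)"
    by (simp add: jordan_XY distrib_left distrib_right mult.assoc)
  finally show ?case
    by (simp add: d pCons.IH jordan_eval_pCons jordan_eval_add distrib_left distrib_right mult.assoc)
qed simp

lemma jordan_normal_form_X_mult:
  "jordan_normal_form (ore_X_mult f) = jordan_var X * jordan_normal_form f"
  by (induction f)
    (simp_all add: ore_X_mult_pCons jordan_normal_form_add jordan_X_mult_eval_Y distrib_left distrib_right
      mult.assoc add_ac)

text \<open>
  The normal form map turns left multiplication by \<open>x\<close> and \<open>y\<close> in the Ore extension into that in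
  \<open>R\<close>. Since these generate \<open>R\<close>, an element is determined by its symbol.
\<close>

lemma jordan_normal_form_symbol [simp]: "jordan_normal_form (jordan_symbol r) = r"
proof (induction r rule: jordan_induct)
  case one
  show ?case
    by (simp add: one_pCons jordan_eval_pCons)
qed (simp_all add: jordan_normal_form_add jordan_normal_form_smult_const ore_mult_pCons_left
    jordan_normal_form_X_mult jordan_normal_form_smult_Y)

lemma jordan_symbol_inject: "jordan_symbol r = jordan_symbol s \<longleftrightarrow> r = s"
  by (metis jordan_normal_form_symbol)

lemma jordan_symbol_eval_Y: "jordan_symbol (jordan_eval p (jordan_var Y)) = [:p:]"
  by (induction p) (simp_all add: jordan_eval_pCons one_pCons)

lemma jordan_Y_cancel:
  assumes "jordan_var Y * r = jordan_var Y * s"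
  shows "r = s"
proof -
  have "smult [:0, 1:] (jordan_symbol r - jordan_symbol s) = 0"
    using arg_cong[OF assms, of jordan_symbol] by (simp add: smult_diff_right)
  then show ?thesis
    by (simp add: jordan_symbol_inject)
qed

text \<open>
  Degrees in \<open>x\<close> add, so a unit lies in \<open>k[y]\<close>; comparing constant coefficients, it is a unit there.
\<close>

lemma jordan_unit_const:
  assumes "r * s = 1"
  obtains a where "a \<noteq> 0" "r = jordan_const a"
proof -
  have rs: "ore_mult (jordan_symbol r) (jordan_symbol s) = 1"
    using arg_cong[OF assms, of jordan_symbol] by simp
  then obtain p where p: "jordan_symbol r = [:p:]"
    using ore_degree_0_of_mult_1 degree_eq_zeroE by metis
  have "p * coeff (jordan_symbol s) 0 = 1"
    using arg_cong[OF rs, of "\<lambda>f. coeff f 0"] by (simp add: p)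
  then obtain a where a: "p = [:a:]"
    by (metis dvd_triv_left is_unit_polyE)
  have "r = jordan_const a"
    by (simp add: p a one_pCons flip: jordan_symbol_inject)
  moreover have "a \<noteq> 0"
    using rs p a by auto
  ultimately show thesis
    using that by blast
qed

lemma jordan_centralizer_Y:
  fixes r :: "'k::field_char_0 jordan_plane"
  assumes "r * jordan_var Y = jordan_var Y * r"
  obtains p where "r = jordan_eval p (jordan_var Y)"
proof -
  have "degree (jordan_symbol r) = 0"
    using arg_cong[OF assms, of jordan_symbol] by (intro ore_centralizer_Y) simp
  then obtain p where "jordan_symbol r = [:p:]"
    by (rule degree_eq_zeroE)
  then have "r = jordan_eval p (jordan_var Y)"
    by (simp add: jordan_symbol_eval_Y flip: jordan_symbol_inject)
  then show thesis
    by (rule that)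
qed

text \<open>
  Setting \<open>y = 0\<close> is a homomorphism to \<open>k[x]\<close> with kernel \<open>yR\<close>. It kills the commutator of \<open>r\<close>
  and \<open>s\<close>, hence the square of \<open>s\<close>, and \<open>k[x]\<close> has no nilpotents.
\<close>

lemma jordan_square_zero_mod_Y:
  assumes "r * s - s * r = s\<^sup>2"
  obtains u where "s = jordan_var Y * u"
proof -
  have "central_scalars (\<lambda>a :: 'a. [:a:])"
    by standard (simp_all add: one_pCons)
  then obtain \<pi> :: "'a jordan_plane \<Rightarrow> 'a poly"
    where \<pi>: "jordan_hom (\<lambda>a. [:a:]) \<pi>" "\<pi> (jordan_var X) = [:0, 1:]" "\<pi> (jordan_var Y) = 0"
    by (rule jordan_plane_universal[where x = "[:0, 1:]" and y = 0]) auto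
  \<comment> \<open>Elements of this form are closed under left multiplication by x because \<open>xy = y(x + y)\<close>.\<close>
  have "\<exists>u. t = jordan_var Y * u + jordan_eval (\<pi> t) (jordan_var X)" for t
  proof (induction t rule: jordan_induct)
    case one
    show ?case
      by (intro exI[of _ 0]) (simp add: jordan_homD[OF \<pi>(1)] one_pCons jordan_eval_pCons)
  next
    case (add r s)
    then obtain u v where u: "r = jordan_var Y * u + jordan_eval (\<pi> r) (jordan_var X)"
        and v: "s = jordan_var Y * v + jordan_eval (\<pi> s) (jordan_var X)"
      by blast
    from arg_cong2[OF u v, of "(+)"]
    have "r + s = jordan_var Y * (u + v) + jordan_eval (\<pi> (r + s)) (jordan_var X)"
      unfolding jordan_homD(2)[OF \<pi>(1)] jordan_eval_add distrib_left by (simp only: add_ac)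
    then show ?case ..
  next
    case (scale a r)
    then obtain u where u: "r = jordan_var Y * u + jordan_eval (\<pi> r) (jordan_var X)"
      by blast
    have "\<pi> (jordan_scale a r) = smult a (\<pi> r)"
      by (simp add: jordan_homD[OF \<pi>(1)])
    with arg_cong[OF u, of "jordan_scale a"]
    have "jordan_scale a r =
        jordan_var Y * jordan_scale a u + jordan_eval (\<pi> (jordan_scale a r)) (jordan_var X)"
      by (simp only: jordan.scale_right_distrib jordan_scale_mult_right jordan_eval_smult)
    then show ?case ..
  next
    case (X r)
    then obtain u where u: "r = jordan_var Y * u + jordan_eval (\<pi> r) (jordan_var X)"
      by blast
    have "\<pi> (jordan_var X * r) = pCons 0 (\<pi> r)"
      by (simp add: jordan_homD[OF \<pi>(1)] \<pi>(2))
    with arg_cong[OF u, of "(*) (jordan_var X)"]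
    have "jordan_var X * r = jordan_var Y * ((jordan_var X + jordan_var Y) * u)
        + jordan_eval (\<pi> (jordan_var X * r)) (jordan_var X)"
      by (simp only: distrib_left mult.assoc[symmetric] jordan_XY)
        (simp add: jordan_eval_pCons distrib_left mult.assoc)
    then show ?case ..
  next
    case (Y r)
    show ?case
      by (intro exI[of _ r]) (simp add: jordan_homD[OF \<pi>(1)] \<pi>(3))
  qed
  then obtain u where u: "s = jordan_var Y * u + jordan_eval (\<pi> s) (jordan_var X)"
    by blast
  have "(\<pi> s)\<^sup>2 = \<pi> (r * s - s * r)"
    by (simp add: assms jordan_homD[OF \<pi>(1)] power2_eq_square)
  also have "\<dots> = 0"
    by (simp add: jordan_homD[OF \<pi>(1)] mult.commute)
  finally have "\<pi> s = 0"
    by simp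
  then have "s = jordan_var Y * u"
    using u by simp
  then show thesis
    by (rule that)
qed

section \<open>Automorphisms\<close>

lemma jordan_endo_scale:
  assumes "jordan_hom jordan_const h"
  shows "h (jordan_scale a r) = jordan_scale a (h r)"
  by (simp add: jordan_homD(4)[OF assms] flip: jordan_scale_eq_mult)

lemma algebra_automorphism_jordan_iff:
  "algebra_automorphism jordan_scale h \<longleftrightarrow> bij h \<and> jordan_hom jordan_const h"
  by (auto simp: algebra_automorphism_def jordan_hom_def simp flip: jordan_scale_eq_mult)

definition triangular_hom ::
    "'k::field \<Rightarrow> 'k poly \<Rightarrow> ('k jordan_plane \<Rightarrow> 'k jordan_plane) \<Rightarrow> bool"
  where "triangular_hom \<alpha> p h \<longleftrightarrow> jordan_hom jordan_const h \<and>
    h (jordan_var X) = jordan_scale \<alpha> (jordan_var X) + jordan_eval p (jordan_var Y) \<and>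
    h (jordan_var Y) = jordan_scale \<alpha> (jordan_var Y)"

lemma triangular_hom_exists: "\<exists>h. triangular_hom \<alpha> p h"
proof -
  let ?x = "jordan_var X :: 'a jordan_plane" and ?y = "jordan_var Y :: 'a jordan_plane"
  let ?p = "jordan_eval p ?y"
  have "(jordan_scale \<alpha> ?x + ?p) * jordan_scale \<alpha> ?y - jordan_scale \<alpha> ?y * (jordan_scale \<alpha> ?x + ?p)
      = jordan_scale \<alpha> (jordan_scale \<alpha> (?x * ?y - ?y * ?x)) + jordan_scale \<alpha> (?p * ?y - ?y * ?p)"
    by (simp add: jordan.scale_right_diff_distrib jordan.scale_right_distrib distrib_left
        distrib_right jordan_scale_mult_left[symmetric] jordan_scale_mult_right[symmetric] del: jordan.scale_scale)
  also have "\<dots> = (jordan_scale \<alpha> ?y)\<^sup>2"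
    by (simp add: jordan_relation jordan_eval_commute power2_eq_square
        jordan_scale_mult_left[symmetric] jordan_scale_mult_right[symmetric])
  finally show ?thesis
    using jordan_plane_universal[OF central_scalars_jordan] unfolding triangular_hom_def by metis
qed

lemma triangular_hom_unique:
  assumes "triangular_hom \<alpha> p g" "triangular_hom \<alpha> p h"
  shows "g = h"
  using assms by (intro jordan_hom_eqI[of jordan_const]) (simp_all add: triangular_hom_def)

lemma triangular_hom_coordinates_unique:
  assumes "triangular_hom \<alpha> p h" "triangular_hom \<beta> q h"
  shows "\<alpha> = \<beta>" "p = q"
proof -
  have "jordan_symbol (h (jordan_var X)) = [:p, [:\<alpha>:]:]" if "triangular_hom \<alpha> p h" for \<alpha> p
    using that by (simp add: triangular_hom_def jordan_symbol_eval_Y)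
  from this[OF assms(1)] this[OF assms(2)] show "\<alpha> = \<beta>" "p = q"
    by simp_all
qed

lemma triangular_hom_id: "triangular_hom 1 0 id"
  by (simp add: triangular_hom_def jordan_hom_def flip: jordan_scale_eq_mult)

lemma triangular_hom_comp:
  assumes g: "triangular_hom \<alpha> p g" and h: "triangular_hom \<beta> q h"
  shows "triangular_hom (\<alpha> * \<beta>) (smult \<beta> p + pcompose q [:0, \<alpha>:]) (g \<circ> h)"
proof -
  have homs: "jordan_hom jordan_const g" "jordan_hom jordan_const h"
    using g h by (simp_all add: triangular_hom_def)
  have "jordan_hom jordan_const (g \<circ> h)"
    using homs by (simp add: jordan_hom_def flip: jordan_scale_eq_mult)
  moreover have "g (jordan_eval q (jordan_var Y)) = jordan_eval (pcompose q [:0, \<alpha>:]) (jordan_var Y)"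
    using g by (intro jordan_hom_eval homs) (simp add: triangular_hom_def)
  ultimately show ?thesis
    using g h unfolding triangular_hom_def
    by (simp add: jordan_homD(2)[OF homs(1)] jordan_endo_scale[OF homs(1)] jordan_eval_add
        jordan_eval_smult jordan.scale_right_distrib mult.commute add.assoc)
qed

text \<open>
  The composition rule, solved for \<open>(\<alpha>, p)(\<beta>, q) = (1, 0)\<close>, yields \<open>\<beta> = 1/\<alpha>\<close> and
  \<open>q(y) = - p(y/\<alpha>)/\<alpha>\<close>; the homomorphism with these parameters is a two-sided inverse.
\<close>

lemma triangular_hom_bij:
  assumes "\<alpha> \<noteq> 0" and h: "triangular_hom \<alpha> p h"
  shows "bij h"
proof -
  define q where "q = - smult (inverse \<alpha>) (pcompose p [:0, inverse \<alpha>:])"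
  obtain g where g: "triangular_hom (inverse \<alpha>) q g"
    using triangular_hom_exists by blast
  have "smult (inverse \<alpha>) p + pcompose q [:0, \<alpha>:] = 0"
    using assms(1)
    by (simp add: q_def pcompose_uminus pcompose_smult pcompose_pCons flip: pcompose_assoc)
  then have "triangular_hom 1 0 (h \<circ> g)"
    using triangular_hom_comp[OF h g] assms(1) by simp
  moreover have "triangular_hom 1 0 (g \<circ> h)"
    using triangular_hom_comp[OF g h] assms(1) by (simp add: q_def)
  ultimately show ?thesis
    using triangular_hom_unique[OF _ triangular_hom_id] o_bij by metis
qed

text \<open>
  The preimages of \<open>x\<close> and \<open>y\<close> satisfy the relation as well, so \<open>y\<close> divides both its image and its
  preimage. Applying \<open>h\<close> to the preimage then leaves a unit next to \<open>y\<close>; once \<open>h(y) = \<alpha> y\<close> is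
  known, the relation pins down \<open>h(x)\<close> up to the centralizer of \<open>y\<close>.
\<close>

lemma jordan_automorphism_triangular:
  fixes h :: "'k::field_char_0 jordan_plane \<Rightarrow> 'k jordan_plane"
  assumes "algebra_automorphism jordan_scale h"
  obtains \<alpha> p where "\<alpha> \<noteq> 0" "triangular_hom \<alpha> p h"
proof -
  let ?x = "jordan_var X :: 'k jordan_plane" and ?y = "jordan_var Y :: 'k jordan_plane"
  have bij: "bij h" and hom: "jordan_hom jordan_const h"
    using assms by (simp_all add: algebra_automorphism_jordan_iff)
  have "h ?x * h ?y - h ?y * h ?x = h (?x * ?y - ?y * ?x)"
    by (simp add: jordan_homD[OF hom])
  then have rel: "h ?x * h ?y - h ?y * h ?x = (h ?y)\<^sup>2"
    by (simp add: jordan_relation power2_eq_square jordan_homD[OF hom])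
  then obtain u where u: "h ?y = ?y * u"
    by (rule jordan_square_zero_mod_Y)
  obtain x' y' where xy': "h x' = ?x" "h y' = ?y"
    using bij by (metis bij_pointE)
  have "h (x' * y' - y' * x') = h (y'\<^sup>2)"
    using jordan_relation by (simp add: jordan_homD[OF hom] xy' power2_eq_square)
  then have "x' * y' - y' * x' = y'\<^sup>2"
    using bij by (simp add: bij_is_inj inj_eq)
  then obtain v where v: "y' = ?y * v"
    by (rule jordan_square_zero_mod_Y)
  have "?y * (u * h v) = ?y * 1"
    using xy'(2) by (simp add: v jordan_homD[OF hom] u mult.assoc)
  then have "u * h v = 1"
    by (rule jordan_Y_cancel)
  then obtain \<alpha> where \<alpha>: "\<alpha> \<noteq> 0" "u = jordan_const \<alpha>"
    by (rule jordan_unit_const)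
  then have y: "h ?y = jordan_scale \<alpha> ?y"
    using u by (simp flip: jordan_scale_mult_right)
  have "jordan_scale \<alpha> (h ?x * ?y - ?y * h ?x) = jordan_scale \<alpha> (jordan_scale \<alpha> (?x * ?y - ?y * ?x))"
    using rel unfolding y jordan_relation power2_eq_square
    by (simp add: jordan.scale_right_diff_distrib
        jordan_scale_mult_left[symmetric] jordan_scale_mult_right[symmetric])
  then have "h ?x * ?y - ?y * h ?x = jordan_scale \<alpha> (?x * ?y - ?y * ?x)"
    using \<alpha>(1) by (simp only: jordan.scale_left_imp_eq)
  then have "(h ?x - jordan_scale \<alpha> ?x) * ?y = ?y * (h ?x - jordan_scale \<alpha> ?x)"
    by (simp add: jordan.scale_right_diff_distrib left_diff_distrib right_diff_distrib
        jordan_scale_mult_left[symmetric] jordan_scale_mult_right[symmetric] algebra_simps)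
  then obtain p where "h ?x - jordan_scale \<alpha> ?x = jordan_eval p ?y"
    by (rule jordan_centralizer_Y)
  then have "h ?x = jordan_scale \<alpha> ?x + jordan_eval p ?y"
    by (simp add: algebra_simps)
  with hom y \<alpha>(1) show thesis
    using that by (simp add: triangular_hom_def)
qed

lemma jordan_automorphism_iff:
  fixes h :: "'k::field_char_0 jordan_plane \<Rightarrow> 'k jordan_plane"
  shows "algebra_automorphism jordan_scale h \<longleftrightarrow> (\<exists>\<alpha> p. \<alpha> \<noteq> 0 \<and> triangular_hom \<alpha> p h)"
  by (metis jordan_automorphism_triangular triangular_hom_bij triangular_hom_def
      algebra_automorphism_jordan_iff)

definition weight_action :: "'k::field \<Rightarrow> 'k poly \<Rightarrow> 'k poly"
  where "weight_action \<alpha> p = smult (inverse \<alpha>) (pcompose p [:0, \<alpha>:])"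

lemma weight_action_mult: "weight_action (\<alpha> * \<beta>) p = weight_action \<alpha> (weight_action \<beta> p)"
  by (simp add: weight_action_def pcompose_smult pcompose_pCons mult.commute flip: pcompose_assoc)

lemma weight_action_1: "weight_action 1 p = p"
  by (simp add: weight_action_def)

lemma weight_action_hom:
  "weight_action \<in> hom (multiplicative_group :: 'k::field monoid) (AutoGroup additive_group)"
proof -
  have bij: "bij (weight_action \<alpha>)" if "\<alpha> \<noteq> 0" for \<alpha> :: 'k
    by (rule o_bij[of "weight_action (inverse \<alpha>)"])
      (use that in \<open>auto simp: weight_action_1 simp flip: weight_action_mult\<close>)
  then have Bij: "weight_action \<alpha> \<in> Bij UNIV" if "\<alpha> \<noteq> 0" for \<alpha> :: 'k
    using that by (simp add: Bij_def)
  show ?thesis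
  proof (rule homI)
    fix \<alpha> :: 'k
    assume "\<alpha> \<in> carrier multiplicative_group"
    then show "weight_action \<alpha> \<in> carrier (AutoGroup additive_group)"
      using Bij by (auto simp: AutoGroup_def auto_def BijGroup_def additive_group_def
        multiplicative_group_def hom_def weight_action_def pcompose_add smult_add_right)
  next
    fix \<alpha> \<beta> :: 'k
    assume "\<alpha> \<in> carrier multiplicative_group" "\<beta> \<in> carrier multiplicative_group"
    then show "weight_action (\<alpha> \<otimes>\<^bsub>multiplicative_group\<^esub> \<beta>) =
        weight_action \<alpha> \<otimes>\<^bsub>AutoGroup additive_group\<^esub> weight_action \<beta>"
      using Bij by (auto simp: AutoGroup_def BijGroup_def additive_group_def
        multiplicative_group_def compose_def weight_action_mult)
  qed
qed

text \<open>
  The polynomial coordinate is \<open>p/\<alpha>\<close> and not \<open>p\<close>: the composition rule \<open>\<beta> p + q(\<alpha> y)\<close> twists both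
  summands, and division by \<open>\<alpha>\<beta>\<close> leaves the first one untouched, as the semidirect product requires.
\<close>

definition automorphism_coordinates ::
    "('k::field jordan_plane \<Rightarrow> 'k jordan_plane) \<Rightarrow> 'k poly \<times> 'k"
  where "automorphism_coordinates h =
    (THE (n, \<alpha>). \<alpha> \<noteq> 0 \<and> triangular_hom \<alpha> (smult \<alpha> n) h)"

lemma automorphism_coordinates_eq:
  assumes "\<alpha> \<noteq> 0" "triangular_hom \<alpha> (smult \<alpha> n) h"
  shows "automorphism_coordinates h = (n, \<alpha>)"
  unfolding automorphism_coordinates_def
proof (rule the_equality)
  fix x
  assume x: "case x of (m, \<beta>) \<Rightarrow> \<beta> \<noteq> 0 \<and> triangular_hom \<beta> (smult \<beta> m) h"
  obtain m \<beta> where "x = (m, \<beta>)"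
    by fastforce
  with x have "triangular_hom \<beta> (smult \<beta> m) h"
    by simp
  from triangular_hom_coordinates_unique[OF this assms(2)]
  have "\<beta> = \<alpha>" "smult (inverse \<alpha>) (smult \<alpha> m) = smult (inverse \<alpha>) (smult \<alpha> n)"
    by simp_all
  then show "x = (n, \<alpha>)"
    using assms(1) \<open>x = (m, \<beta>)\<close> by simp
qed (use assms in simp)

lemma jordan_automorphism_cases:
  fixes h :: "'k::field_char_0 jordan_plane \<Rightarrow> 'k jordan_plane"
  assumes "algebra_automorphism jordan_scale h"
  obtains n \<alpha> where "\<alpha> \<noteq> 0" "triangular_hom \<alpha> (smult \<alpha> n) h"
proof -
  obtain \<alpha> p where "\<alpha> \<noteq> 0" "triangular_hom \<alpha> p h"
    using assms by (rule jordan_automorphism_triangular)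
  then have "triangular_hom \<alpha> (smult \<alpha> (smult (inverse \<alpha>) p)) h"
    by simp
  with \<open>\<alpha> \<noteq> 0\<close> show thesis
    by (rule that)
qed

lemma automorphism_coordinates_iso:
  "automorphism_coordinates \<in> iso
    (algebra_Aut (jordan_scale :: 'k::field_char_0 \<Rightarrow> 'k jordan_plane \<Rightarrow> 'k jordan_plane))
    (semidirect_product additive_group multiplicative_group weight_action)"
  (is "_ \<in> iso ?A ?S")
proof -
  have carrier_A: "carrier ?A = {h. algebra_automorphism jordan_scale h}"
    by (simp add: algebra_Aut_def)
  have carrier_S: "carrier ?S = {(n, \<alpha>). \<alpha> \<noteq> 0}"
    by (auto simp: semidirect_product_def additive_group_def multiplicative_group_def)
  have "automorphism_coordinates \<in> hom ?A ?S"
  proof (rule homI)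
    fix h
    assume "h \<in> carrier ?A"
    then obtain n \<alpha> where "\<alpha> \<noteq> 0" "triangular_hom \<alpha> (smult \<alpha> n) h"
      unfolding carrier_A by (auto elim: jordan_automorphism_cases)
    then show "automorphism_coordinates h \<in> carrier ?S"
      by (simp add: automorphism_coordinates_eq carrier_S)
  next
    fix g h
    assume "g \<in> carrier ?A" "h \<in> carrier ?A"
    then obtain n \<alpha> m \<beta> where g: "\<alpha> \<noteq> 0" "triangular_hom \<alpha> (smult \<alpha> n) g"
        and h: "\<beta> \<noteq> 0" "triangular_hom \<beta> (smult \<beta> m) h"
      unfolding carrier_A by (metis jordan_automorphism_cases mem_Collect_eq)
    have "smult \<beta> (smult \<alpha> n) + pcompose (smult \<beta> m) [:0, \<alpha>:] =
        smult (\<alpha> * \<beta>) (n + weight_action \<alpha> m)"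
    proof -
      have "\<alpha> * \<beta> * inverse \<alpha> = \<beta>"
        using g(1) by simp
      then show ?thesis
        by (simp only: weight_action_def pcompose_smult smult_add_right smult_smult
            mult.commute[of \<beta> \<alpha>])
    qed
    with triangular_hom_comp[OF g(2) h(2)]
    have "triangular_hom (\<alpha> * \<beta>) (smult (\<alpha> * \<beta>) (n + weight_action \<alpha> m)) (g \<circ> h)"
      by simp
    with g h show "automorphism_coordinates (g \<otimes>\<^bsub>?A\<^esub> h) =
        automorphism_coordinates g \<otimes>\<^bsub>?S\<^esub> automorphism_coordinates h"
      by (simp add: automorphism_coordinates_eq algebra_Aut_def semidirect_product_def
          additive_group_def multiplicative_group_def)
  qed
  moreover have "bij_betw automorphism_coordinates (carrier ?A) (carrier ?S)"
  proof (rule bij_betw_imageI)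
    show "inj_on automorphism_coordinates (carrier ?A)"
    proof (rule inj_onI)
      fix g h
      assume "g \<in> carrier ?A" "h \<in> carrier ?A"
        and eq: "automorphism_coordinates g = automorphism_coordinates h"
      then obtain n \<alpha> m \<beta> where g: "\<alpha> \<noteq> 0" "triangular_hom \<alpha> (smult \<alpha> n) g"
          and h: "\<beta> \<noteq> 0" "triangular_hom \<beta> (smult \<beta> m) h"
        unfolding carrier_A by (metis jordan_automorphism_cases mem_Collect_eq)
      then have "n = m" "\<alpha> = \<beta>"
        using eq by (simp_all add: automorphism_coordinates_eq)
      with g h show "g = h"
        using triangular_hom_unique by blast
    qed
    show "automorphism_coordinates ` carrier ?A = carrier ?S"
    proof
      show "automorphism_coordinates ` carrier ?A \<subseteq> carrier ?S"
        using \<open>automorphism_coordinates \<in> hom ?A ?S\<close> by (auto simp: hom_def)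
      show "carrier ?S \<subseteq> automorphism_coordinates ` carrier ?A"
      proof
        fix x
        assume "x \<in> carrier ?S"
        then obtain n \<alpha> where x: "x = (n, \<alpha>)" "\<alpha> \<noteq> 0"
          unfolding carrier_S by blast
        obtain h where h: "triangular_hom \<alpha> (smult \<alpha> n) h"
          using triangular_hom_exists by blast
        then have "h \<in> carrier ?A"
          unfolding carrier_A using x(2) jordan_automorphism_iff by blast
        moreover have "x = automorphism_coordinates h"
          using automorphism_coordinates_eq[OF x(2) h] x(1) by simp
        ultimately show "x \<in> automorphism_coordinates ` carrier ?A"
          by blast
      qed
    qed
  qed
  ultimately show ?thesis
    by (simp add: iso_def)
qed

theorem theorem2:
  shows "(\<forall>\<phi>. algebra_automorphism jordan_scale \<phi> \<longrightarrow>
      (\<exists>(\<alpha> :: 'k :: {alg_closed_field, field_char_0}) (p :: 'k poly). \<alpha> \<noteq> 0 \<and>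
        \<phi> (jordan_var X) = jordan_scale \<alpha> (jordan_var X) + eval_poly jordan_scale p (jordan_var Y) \<and>
        \<phi> (jordan_var Y) = jordan_scale \<alpha> (jordan_var Y))) \<and>
    (\<forall>(\<alpha> :: 'k) (p :: 'k poly). \<alpha> \<noteq> 0 \<longrightarrow>
      (\<exists>\<phi>. algebra_automorphism jordan_scale \<phi> \<and>
        \<phi> (jordan_var X) = jordan_scale \<alpha> (jordan_var X) + eval_poly jordan_scale p (jordan_var Y) \<and>
        \<phi> (jordan_var Y) = jordan_scale \<alpha> (jordan_var Y))) \<and>
    (\<exists>\<theta> \<in> hom (multiplicative_group :: 'k monoid) (AutoGroup (additive_group :: 'k poly monoid)).
      algebra_Aut (jordan_scale :: 'k \<Rightarrow> 'k jordan_plane \<Rightarrow> 'k jordan_plane) \<cong>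
        semidirect_product additive_group multiplicative_group \<theta>)"
proof (intro conjI)
  show "\<forall>\<phi>. algebra_automorphism jordan_scale \<phi> \<longrightarrow>
      (\<exists>(\<alpha> :: 'k) (p :: 'k poly). \<alpha> \<noteq> 0 \<and>
        \<phi> (jordan_var X) = jordan_scale \<alpha> (jordan_var X) + eval_poly jordan_scale p (jordan_var Y) \<and>
        \<phi> (jordan_var Y) = jordan_scale \<alpha> (jordan_var Y))"
    unfolding jordan_automorphism_iff triangular_hom_def by blast
  show "\<forall>(\<alpha> :: 'k) (p :: 'k poly). \<alpha> \<noteq> 0 \<longrightarrow>
      (\<exists>\<phi>. algebra_automorphism jordan_scale \<phi> \<and>
        \<phi> (jordan_var X) = jordan_scale \<alpha> (jordan_var X) + eval_poly jordan_scale p (jordan_var Y) \<and>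
        \<phi> (jordan_var Y) = jordan_scale \<alpha> (jordan_var Y))"
    using triangular_hom_exists jordan_automorphism_iff unfolding triangular_hom_def by metis
  show "\<exists>\<theta> \<in> hom (multiplicative_group :: 'k monoid) (AutoGroup (additive_group :: 'k poly monoid)).
      algebra_Aut (jordan_scale :: 'k \<Rightarrow> 'k jordan_plane \<Rightarrow> 'k jordan_plane) \<cong>
        semidirect_product additive_group multiplicative_group \<theta>"
    using weight_action_hom automorphism_coordinates_iso is_isoI by blast
qed

end
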